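(* Let $n\ge 2$ be an integer, let $\mathbf p=(p_1,\dots,p_n)\in[0,1]^n$, and consider the fully symmetric $n$-player model with parameter $\mathbf p$. The effects $E_1,\dots,E_n$ are pairwise independent (equivalently, each pair of distinct effects $E_i,E_j$ is screened off by any cause $C_k$, $1\le k\le n$) if and only if $\psi(\mathbf p)=0$, where $$\psi(\mathbf p)=\bigg(\frac{1}{2^{n-1}}\sum_{k=0}^{n-1}\binom{n-1}{k}p_{k+1}\bigg)^2-\frac{1}{2^{n-1}}\sum_{k=0}^{n-2}\binom{n-2}{k}\big(p_{k+2}^2+p_{k+1}p_{n-(k+1)}\big).$$
   Context: Fully symmetric (GST) model with parameter $\mathbf p\in[0,1]^n$: $C_1,\dots,C_n$ (causes) are mutually independent $\{0,1\}$-valued random variables with $\mathbb P(C_i=1)=1/2$; $E_1,\dots,E_n$ (effects) are $\{0,1\}$-valued random variables that are conditionally independent given the joint outcome of all the causes, with $$\mathbb P\Big(E_i=1\;\Big|\;\bigwedge_{j=1}^n C_j=x_j\Big)=p_k,\qquad k=\#\{j\in\{1,\dots,n\}: x_j=x_i\},$$ for every $(x_1,\dots,x_n)\in\{0,1\}^n$. A cause $C_k$ screens off $E_i$ from $E_j$ if $E_i$ and $E_j$ are conditionally independent given $C_k$, i.e. $\mathbb P(E_i=1\wedge E_j=1\mid C_k=x)=\mathbb P(E_i=1\mid C_k=x)\,\mathbb P(E_j=1\mid C_k=x)$ for $x\in\{0,1\}$. *)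

theory Defs
  imports "HOL-Probability.Probability"
begin

text \<open>
  Causes and effects are indexed by \<open>{1..n}\<close>; only the values \<open>p k\<close> with \<open>k \<in> {1..n}\<close> of the
  parameter matter. Values outside these ranges are unconstrained and never used.
\<close>

text \<open>Measurability into \<open>count_space {0, 1}\<close> makes a variable \<open>{0, 1}\<close>-valued on all of \<open>space M\<close>.\<close>

abbreviation bit_space :: "nat measure" where
  "bit_space \<equiv> count_space {0, 1}"

text \<open>
  Conditional independence given an outcome \<open>x\<close> of the causes is mutual independence under the
  conditional probability measure \<open>A \<mapsto> P(A | C\<^sub>1 = x\<^sub>1, ..., C\<^sub>n = x\<^sub>n)\<close>, which is
  \<open>uniform_measure M\<close> of that event; the event has probability \<open>1 / 2 ^ n > 0\<close>.
\<close>

locale symmetric_model = prob_space M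
  for M :: "'a measure" +
  fixes n :: nat and p :: "nat \<Rightarrow> real" and C E :: "nat \<Rightarrow> 'a \<Rightarrow> nat"
  assumes causes_indep: "indep_vars (\<lambda>_. bit_space) C {1..n}"
    and causes_fair: "\<And>i. i \<in> {1..n} \<Longrightarrow> \<P>(\<omega> in M. C i \<omega> = 1) = 1 / 2"
    and effects_rv: "\<And>i. i \<in> {1..n} \<Longrightarrow> random_variable bit_space (E i)"
    and effects_cond_indep: "\<And>x. x \<in> {1..n} \<rightarrow> {0, 1} \<Longrightarrow>
      prob_space.indep_vars (uniform_measure M {\<omega> \<in> space M. \<forall>j\<in>{1..n}. C j \<omega> = x j})
        (\<lambda>_. bit_space) E {1..n}"
    and effects_cond_prob: "\<And>x i. x \<in> {1..n} \<rightarrow> {0, 1} \<Longrightarrow> i \<in> {1..n} \<Longrightarrow>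
      \<P>(\<omega> in M. E i \<omega> = 1 \<bar> \<forall>j\<in>{1..n}. C j \<omega> = x j) = p (card {j \<in> {1..n}. x j = x i})"

definition screens_off ::
  "'a measure \<Rightarrow> ('a \<Rightarrow> nat) \<Rightarrow> ('a \<Rightarrow> nat) \<Rightarrow> ('a \<Rightarrow> nat) \<Rightarrow> bool" where
  "screens_off M Z X Y \<longleftrightarrow> (\<forall>x\<in>{0, 1}.
     \<P>(\<omega> in M. X \<omega> = 1 \<and> Y \<omega> = 1 \<bar> Z \<omega> = x) =
     \<P>(\<omega> in M. X \<omega> = 1 \<bar> Z \<omega> = x) * \<P>(\<omega> in M. Y \<omega> = 1 \<bar> Z \<omega> = x))"

definition pairwise_indep_effects :: "'a measure \<Rightarrow> nat \<Rightarrow> (nat \<Rightarrow> 'a \<Rightarrow> nat) \<Rightarrow> bool" where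
  "pairwise_indep_effects M n E \<longleftrightarrow> (\<forall>i\<in>{1..n}. \<forall>j\<in>{1..n}. i \<noteq> j \<longrightarrow>
     prob_space.indep_var M bit_space (E i) bit_space (E j))"

text \<open>The natural-number subtractions below do not truncate when \<open>n \<ge> 2\<close>.\<close>

definition psi :: "nat \<Rightarrow> (nat \<Rightarrow> real) \<Rightarrow> real" where
  "psi n p =
     (1 / 2 ^ (n - 1) * (\<Sum>k=0..n-1. real ((n - 1) choose k) * p (k + 1)))\<^sup>2
     - 1 / 2 ^ (n - 1) * (\<Sum>k=0..n-2. real ((n - 2) choose k) *
         ((p (k + 2))\<^sup>2 + p (k + 1) * p (n - (k + 1))))"

end

theory Submission
  imports Defs
begin

text \<open>
  Flipping all the causes at once preserves the law of the effects, so conditioning on a single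
  cause changes neither the law of \<open>E\<^sub>i\<close> nor that of a pair \<open>(E\<^sub>i, E\<^sub>j)\<close>. Hence both conditions
  say that the covariance of the indicators \<open>E\<^sub>i\<close>, \<open>E\<^sub>j\<close> vanishes, and summing over the set \<open>T\<close> of
  causes equal to 1 (by flip symmetry, only those with \<open>i \<in> T\<close>, then split by \<open>j \<in> T\<close>) shows that
  this covariance is \<open>- psi n p\<close>.
\<close>

text \<open>Keeps the simplifier from turning \<open>1\<close> into \<open>Suc 0\<close>, so that
  equations such as \<open>C j \<omega> = 1\<close> and arguments \<open>k + 1\<close> retain the
  form in which facts are stated.\<close>

declare One_nat_def [simp del]

section \<open>Sums over the subsets of a finite set\<close>

lemma sum_Pow_card:
  fixes f :: "nat \<Rightarrow> real"
  assumes "finite B"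
  shows "(\<Sum>T\<in>Pow B. f (card T)) = (\<Sum>k=0..card B. real (card B choose k) * f k)"
proof -
  have "(\<Sum>T\<in>Pow B. f (card T)) = (\<Sum>k=0..card B. \<Sum>T\<in>{T\<in>Pow B. card T = k}. f (card T))"
    by (rule sum.group[symmetric]) (use assms in \<open>auto simp: card_mono\<close>)
  also have "\<dots> = (\<Sum>k=0..card B. real (card B choose k) * f k)"
    using n_subsets[OF assms] by (intro sum.cong) auto
  finally show ?thesis .
qed

text \<open>Source of the binomial sums in \<open>psi\<close>: inserting a fresh \<open>i\<close> is
  injective on \<open>Pow B\<close> and raises each cardinality by one, which shifts the argument to
  \<open>k + 1\<close>.\<close>

lemma sum_Pow_insert_card:
  fixes g :: "nat \<Rightarrow> real"
  assumes "finite B" "i \<notin> B"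
  shows "(\<Sum>T\<in>insert i ` Pow B. g (card T))
    = (\<Sum>k=0..card B. real (card B choose k) * g (k + 1))"
proof -
  have inj: "inj_on (insert i) (Pow B)"
    using assms(2) by (auto simp: inj_on_def)
  have "(\<Sum>T\<in>insert i ` Pow B. g (card T)) = (\<Sum>T\<in>Pow B. g (card (insert i T)))"
    by (subst sum.reindex[OF inj]) simp
  also have "\<dots> = (\<Sum>T\<in>Pow B. g (card T + 1))"
  proof (rule sum.cong[OF refl])
    fix T assume "T \<in> Pow B"
    then have "finite T" "i \<notin> T" using assms by (auto intro: finite_subset)
    then show "g (card (insert i T)) = g (card T + 1)" by (simp add: Suc_eq_plus1)
  qed
  also have "\<dots> = (\<Sum>k=0..card B. real (card B choose k) * g (k + 1))"
    by (rule sum_Pow_card[OF assms(1)])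
  finally show ?thesis .
qed

section \<open>Independence of two bits\<close>

text \<open>The single event that a bit equals 1 generates its whole sigma-algebra, so the product
  rule for one pair of events already yields independence. This connects \<open>indep_var\<close>
  with \<open>screens_off\<close>, which speaks of the value 1 only.\<close>

lemma (in prob_space) indep_var_bits_iff:
  assumes X: "random_variable bit_space X" and Y: "random_variable bit_space Y"
  shows "indep_var bit_space X bit_space Y \<longleftrightarrow>
    \<P>(\<omega> in M. X \<omega> = 1 \<and> Y \<omega> = 1) = \<P>(\<omega> in M. X \<omega> = 1) * \<P>(\<omega> in M. Y \<omega> = 1)"
    (is "?L \<longleftrightarrow> ?R")
proof
  have eq: "X -` {1} \<inter> space M = {\<omega>\<in>space M. X \<omega> = 1}"
    "Y -` {1} \<inter> space M = {\<omega>\<in>space M. Y \<omega> = 1}"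
    "(\<lambda>\<omega>. (X \<omega>, Y \<omega>)) -` ({1} \<times> {1}) \<inter> space M = {\<omega>\<in>space M. X \<omega> = 1 \<and> Y \<omega> = 1}"
    by auto
  show ?R if ?L
    using indep_varD[OF that, of "{1}" "{1}"] unfolding eq by simp
next
  assume R: ?R
  let ?A = "\<lambda>Z. {\<omega>\<in>space M. Z \<omega> = (1::nat)}"
  have ev: "?A Z \<in> events" if "random_variable bit_space Z" for Z
    using measurable_sets[OF that, of "{1}"] by (simp add: vimage_def Int_def conj_commute)
  \<comment> \<open>The preimage of any set of bits is the whole space, the event
    \<open>?A Z\<close>, its complement or empty, according to which of 0 and 1 the set
    contains.\<close>
  have sub: "sigma_sets (space M) {Z -` A \<inter> space M |A. A \<in> sets bit_space}
      \<subseteq> sigma_sets (space M) {?A Z}" if Z: "random_variable bit_space Z" for Z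
  proof (rule sigma_sets_mono, safe)
    fix A assume A: "A \<in> sets bit_space"
    have val: "Z \<omega> = 0 \<or> Z \<omega> = 1" if "\<omega> \<in> space M" for \<omega>
      using measurable_space[OF Z that] by auto
    interpret S: sigma_algebra "space M" "sigma_sets (space M) {?A Z}"
      by (rule sigma_algebra_sigma_sets) auto
    have mem: "?A Z \<in> sigma_sets (space M) {?A Z}" by (rule sigma_sets.Basic) simp
    consider "0 \<in> A" "1 \<in> A" | "0 \<in> A" "1 \<notin> A" | "0 \<notin> A" "1 \<in> A" | "0 \<notin> A" "1 \<notin> A" by blast
    then show "Z -` A \<inter> space M \<in> sigma_sets (space M) {?A Z}"
    proof cases
      case 1
      then have "Z -` A \<inter> space M = space M" using val by force
      then show ?thesis using S.top by simp
    next
      case 2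
      then have "Z -` A \<inter> space M = space M - ?A Z" using val by force
      then show ?thesis using S.compl_sets[OF mem] by simp
    next
      case 3
      then have "Z -` A \<inter> space M = ?A Z" using val by force
      then show ?thesis using mem by simp
    next
      case 4
      then have "Z -` A \<inter> space M = {}" using val by force
      then show ?thesis by simp
    qed
  qed
  have "?A X \<inter> ?A Y = {\<omega>\<in>space M. X \<omega> = 1 \<and> Y \<omega> = 1}" by auto
  then have "indep_set {?A X} {?A Y}"
    using R ev[OF X] ev[OF Y] unfolding indep_sets2_eq by simp
  \<comment> \<open>A family with one member is closed under intersection, so independence extends
    from the generators to the generated sigma-algebras.\<close>
  then have ind: "indep_set (sigma_sets (space M) {?A X}) (sigma_sets (space M) {?A Y})"
    by (rule indep_set_sigma_sets) (auto simp: Int_stable_def)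
  have "indep_set (sigma_sets (space M) {X -` A \<inter> space M |A. A \<in> sets bit_space})
      (sigma_sets (space M) {Y -` A \<inter> space M |A. A \<in> sets bit_space})"
    unfolding indep_sets2_eq
    by (intro conjI ballI order.trans[OF sub[OF X] indep_setD_ev1[OF ind]]
        order.trans[OF sub[OF Y] indep_setD_ev2[OF ind]]
        indep_setD[OF ind subsetD[OF sub[OF X]] subsetD[OF sub[OF Y]]])
  then show ?L unfolding indep_var_eq using X Y by blast
qed

section \<open>Joint outcomes of the causes\<close>

context symmetric_model
begin

text \<open>An outcome vector of the causes is encoded by its support \<open>T\<close>. Sums over
  outcomes become sums over subsets, and the global flip becomes complementation.\<close>

definition cell :: "nat set \<Rightarrow> 'a set" where
  "cell T = {\<omega>\<in>space M. {j\<in>{1..n}. C j \<omega> = 1} = T}"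

text \<open>The index at which \<open>p\<close> is evaluated for the effect \<open>i\<close>: the
  number of causes that agree with cause \<open>i\<close> in the outcome with support
  \<open>T\<close>.\<close>

definition same :: "nat set \<Rightarrow> nat \<Rightarrow> nat" where
  "same T i = (if i \<in> T then card T else n - card T)"

lemma cause_rv: "i \<in> {1..n} \<Longrightarrow> random_variable bit_space (C i)"
  using causes_indep unfolding indep_vars_def by blast

lemma cause_bit: "i \<in> {1..n} \<Longrightarrow> \<omega> \<in> space M \<Longrightarrow> C i \<omega> = 0 \<or> C i \<omega> = 1"
  using measurable_space[OF cause_rv] by fastforce

lemma cause_event: "i \<in> {1..n} \<Longrightarrow> {\<omega>\<in>space M. C i \<omega> = b} \<in> events"
proof -
  assume i: "i \<in> {1..n}"
  \<comment> \<open>Here \<open>b\<close> is arbitrary; intersecting with \<open>{0, 1}\<close>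
    gives a set of \<open>bit_space\<close> with the same preimage, since \<open>C i\<close> takes
    no other value.\<close>
  have "C i -` ({b} \<inter> {0, 1}) \<inter> space M \<in> events"
    by (rule measurable_sets[OF cause_rv[OF i]]) simp
  moreover have "C i -` ({b} \<inter> {0, 1}) \<inter> space M = {\<omega>\<in>space M. C i \<omega> = b}"
    using cause_bit[OF i] by auto
  ultimately show ?thesis by simp
qed

lemma effect_event: "i \<in> {1..n} \<Longrightarrow> {\<omega>\<in>space M. E i \<omega> = 1} \<in> events"
  using measurable_sets[OF effects_rv, of i "{1}"]
  by (simp add: vimage_def Int_def conj_commute)

lemma cause_prob:
  assumes i: "i \<in> {1..n}" and b: "b \<in> {0, 1}"
  shows "\<P>(\<omega> in M. C i \<omega> = b) = 1 / 2"
proof (cases "b = 1")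
  case False
  then have "{\<omega>\<in>space M. C i \<omega> = b} = space M - {\<omega>\<in>space M. C i \<omega> = 1}"
    using b cause_bit[OF i] by force
  then show ?thesis using prob_compl[OF cause_event[OF i, of 1]] causes_fair[OF i] by simp
qed (simp add: causes_fair[OF i])

text \<open>Translates to the language of the locale assumptions, with the indicator of
  \<open>T\<close> as the outcome vector \<open>x\<close>.\<close>

lemma cell_eq:
  assumes "T \<subseteq> {1..n}"
  shows "cell T = {\<omega>\<in>space M. \<forall>j\<in>{1..n}. C j \<omega> = of_bool (j \<in> T)}"
proof -
  have "{j\<in>{1..n}. C j \<omega> = 1} = T \<longleftrightarrow> (\<forall>j\<in>{1..n}. C j \<omega> = of_bool (j \<in> T))"
    if "\<omega> \<in> space M" for \<omega>
  proof
    assume *: "{j\<in>{1..n}. C j \<omega> = 1} = T"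
    show "\<forall>j\<in>{1..n}. C j \<omega> = of_bool (j \<in> T)"
      using cause_bit[OF _ that] * by fastforce
  next
    assume *: "\<forall>j\<in>{1..n}. C j \<omega> = of_bool (j \<in> T)"
    show "{j\<in>{1..n}. C j \<omega> = 1} = T"
    proof (rule set_eqI)
      fix j show "j \<in> {j\<in>{1..n}. C j \<omega> = 1} \<longleftrightarrow> j \<in> T"
        using * assms by (cases "j \<in> {1..n}") auto
    qed
  qed
  then show ?thesis unfolding cell_def by (intro Collect_cong conj_cong refl)
qed

lemma cell_event:
  assumes "T \<subseteq> {1..n}"
  shows "cell T \<in> events"
  unfolding cell_eq[OF assms] by (rule sets.sets_Collect_finite_All) (auto intro: cause_event)

lemma cell_prob:
  assumes n: "n \<ge> 1" and T: "T \<subseteq> {1..n}"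
  shows "prob (cell T) = 1 / 2 ^ n"
proof -
  \<comment> \<open>For \<open>n = 0\<close> the intersection would be \<open>UNIV\<close> instead
    of \<open>space M\<close>; this is where \<open>n \<ge> 1\<close> enters.\<close>
  have eq: "cell T = (\<Inter>j\<in>{1..n}. C j -` {of_bool (j \<in> T)} \<inter> space M)"
    unfolding cell_eq[OF T] using n by auto
  have "prob (cell T) = (\<Prod>j\<in>{1..n}. prob (C j -` {of_bool (j \<in> T)} \<inter> space M))"
    unfolding eq by (rule indep_varsD[OF causes_indep]) (use n in auto)
  also have "\<dots> = (\<Prod>j\<in>{1..n}. 1 / 2)"
  proof (rule prod.cong[OF refl])
    fix j assume j: "j \<in> {1..n}"
    have "C j -` {of_bool (j \<in> T)} \<inter> space M = {\<omega>\<in>space M. C j \<omega> = of_bool (j \<in> T)}" by auto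
    then show "prob (C j -` {of_bool (j \<in> T)} \<inter> space M) = 1 / 2"
      using cause_prob[OF j, of "of_bool (j \<in> T)"] by simp
  qed
  also have "\<dots> = 1 / 2 ^ n" by (simp add: power_one_over)
  finally show ?thesis .
qed

lemma same_eq:
  assumes T: "T \<subseteq> {1..n}" and i: "i \<in> {1..n}"
  shows "card {j \<in> {1..n}. (of_bool (j \<in> T) :: nat) = of_bool (i \<in> T)} = same T i"
proof (cases "i \<in> T")
  case True
  then have "{j \<in> {1..n}. (of_bool (j \<in> T) :: nat) = of_bool (i \<in> T)} = T" using T by auto
  then show ?thesis using True by (simp add: same_def)
next
  case False
  then have "{j \<in> {1..n}. (of_bool (j \<in> T) :: nat) = of_bool (i \<in> T)} = {1..n} - T" by auto
  moreover have "card ({1..n} - T) = n - card T"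
    using T by (subst card_Diff_subset) (auto intro: finite_subset)
  ultimately show ?thesis using False by (simp add: same_def)
qed

lemma effect_cell_prob:
  assumes n: "n \<ge> 1" and T: "T \<subseteq> {1..n}" and i: "i \<in> {1..n}"
  shows "prob ({\<omega>\<in>space M. E i \<omega> = 1} \<inter> cell T) = p (same T i) / 2 ^ n"
proof -
  have "\<P>(\<omega> in M. E i \<omega> = 1 \<bar> \<forall>j\<in>{1..n}. C j \<omega> = of_bool (j \<in> T)) = p (same T i)"
    using effects_cond_prob[of "\<lambda>j. of_bool (j \<in> T)" i] i same_eq[OF T i] by auto
  moreover have "{\<omega>\<in>space M. E i \<omega> = 1} \<inter> cell T
      = {\<omega>\<in>space M. E i \<omega> = 1 \<and> (\<forall>j\<in>{1..n}. C j \<omega> = of_bool (j \<in> T))}"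
    unfolding cell_eq[OF T] by auto
  ultimately show ?thesis
    using cell_prob[OF n T] unfolding cond_prob_def cell_eq[OF T, symmetric]
    by (simp add: field_simps)
qed

text \<open>Within a cell the effects are independent, so their conditional probabilities multiply,
  while the mass of the cell enters only once.\<close>

lemma effects_cell_prob:
  assumes n: "n \<ge> 1" and T: "T \<subseteq> {1..n}" and i: "i \<in> {1..n}" and j: "j \<in> {1..n}" and ij: "i \<noteq> j"
  shows "prob ({\<omega>\<in>space M. E i \<omega> = 1 \<and> E j \<omega> = 1} \<inter> cell T)
    = p (same T i) * p (same T j) / 2 ^ n"
proof -
  let ?U = "uniform_measure M (cell T)"
  let ?A = "\<lambda>k. {\<omega>\<in>space M. E k \<omega> = 1}"
  \<comment> \<open>The cell has positive finite mass, so conditioning on it gives a probability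
    measure.\<close>
  have pos: "emeasure M (cell T) \<noteq> 0" "emeasure M (cell T) \<noteq> \<infinity>"
    using cell_prob[OF n T] by (auto simp: emeasure_eq_measure)
  interpret U: prob_space ?U by (rule prob_space_uniform_measure[OF pos])
  \<comment> \<open>The factor \<open>2 ^ n\<close> is the reciprocal of the probability of the
    cell.\<close>
  have meas: "measure ?U A = prob (A \<inter> cell T) * 2 ^ n" if "A \<in> events" for A
    using measure_uniform_measure[OF pos that] cell_prob[OF n T] by (simp add: Int_commute)
  have ind: "U.indep_vars (\<lambda>_. bit_space) E {1..n}"
    using effects_cond_indep[of "\<lambda>j. of_bool (j \<in> T)"] unfolding cell_eq[OF T] by auto
  have "measure ?U (\<Inter>k\<in>{i, j}. E k -` {1} \<inter> space ?U)
      = (\<Prod>k\<in>{i, j}. measure ?U (E k -` {1} \<inter> space ?U))"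
    by (rule U.indep_varsD[OF ind]) (use i j in auto)
  moreover have "(\<Inter>k\<in>{i, j}. E k -` {1} \<inter> space ?U) = ?A i \<inter> ?A j" by auto
  moreover have "E k -` {1} \<inter> space ?U = ?A k" for k by auto
  ultimately have "measure ?U (?A i \<inter> ?A j) = measure ?U (?A i) * measure ?U (?A j)"
    using ij by simp
  moreover have "?A i \<inter> ?A j = {\<omega>\<in>space M. E i \<omega> = 1 \<and> E j \<omega> = 1}" by auto
  ultimately show ?thesis
    using meas[OF effect_event[OF i]] meas[OF effect_event[OF j]]
      meas[OF sets.Int[OF effect_event[OF i] effect_event[OF j]]]
      effect_cell_prob[OF n T i] effect_cell_prob[OF n T j]
    by (simp add: field_simps)
qed

section \<open>Decomposition of events over cells\<close>

text \<open>The cells are disjoint, and each sample point lies in the cell indexed by its own set of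
  causes equal to 1; by \<open>sub\<close> only cells indexed by \<open>S\<close> meet
  \<open>A\<close>.\<close>

lemma prob_eq_sum_cells:
  assumes A: "A \<in> events" and S: "S \<subseteq> Pow {1..n}"
    and sub: "\<And>\<omega>. \<omega> \<in> A \<Longrightarrow> {j\<in>{1..n}. C j \<omega> = 1} \<in> S"
  shows "prob A = (\<Sum>T\<in>S. prob (A \<inter> cell T))"
proof -
  have fin: "finite S" by (rule finite_subset[OF S]) simp
  have "A = (\<Union>T\<in>S. A \<inter> cell T)"
    using sub sets.sets_into_space[OF A] by (auto simp: cell_def)
  then have "prob A = prob (\<Union>T\<in>S. A \<inter> cell T)" by (rule arg_cong)
  also have "\<dots> = (\<Sum>T\<in>S. prob (A \<inter> cell T))"
    by (rule finite_measure_finite_Union[OF fin])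
      (use A S cell_event in \<open>auto simp: disjoint_family_on_def cell_def\<close>)
  finally show ?thesis .
qed

lemma prob_cause_1:
  assumes A: "A \<in> events" and k: "k \<in> {1..n}"
  shows "prob (A \<inter> {\<omega>\<in>space M. C k \<omega> = 1}) = (\<Sum>T\<in>{T\<in>Pow {1..n}. k \<in> T}. prob (A \<inter> cell T))"
proof -
  have "prob (A \<inter> {\<omega>\<in>space M. C k \<omega> = 1})
      = (\<Sum>T\<in>{T\<in>Pow {1..n}. k \<in> T}. prob (A \<inter> {\<omega>\<in>space M. C k \<omega> = 1} \<inter> cell T))"
    by (rule prob_eq_sum_cells) (use sets.Int[OF A cause_event[OF k]] k in auto)
  also have "\<dots> = (\<Sum>T\<in>{T\<in>Pow {1..n}. k \<in> T}. prob (A \<inter> cell T))"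
    by (intro sum.cong refl arg_cong[where f = prob]) (auto simp: cell_def)
  finally show ?thesis .
qed

lemma prob_cause_0:
  assumes A: "A \<in> events" and k: "k \<in> {1..n}"
  shows "prob (A \<inter> {\<omega>\<in>space M. C k \<omega> = 0}) = (\<Sum>T\<in>{T\<in>Pow {1..n}. k \<notin> T}. prob (A \<inter> cell T))"
proof -
  have "prob (A \<inter> {\<omega>\<in>space M. C k \<omega> = 0})
      = (\<Sum>T\<in>{T\<in>Pow {1..n}. k \<notin> T}. prob (A \<inter> {\<omega>\<in>space M. C k \<omega> = 0} \<inter> cell T))"
    by (rule prob_eq_sum_cells) (use sets.Int[OF A cause_event[OF k]] k in auto)
  also have "\<dots> = (\<Sum>T\<in>{T\<in>Pow {1..n}. k \<notin> T}. prob (A \<inter> cell T))"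
  proof (rule sum.cong[OF refl])
    fix T assume "T \<in> {T\<in>Pow {1..n}. k \<notin> T}"
    \<comment> \<open>Since causes are two-valued, a cause missing from the support must be
      0.\<close>
    then have "C k \<omega> = 0" if "\<omega> \<in> cell T" for \<omega>
      using that cause_bit[OF k, of \<omega>] k by (auto simp: cell_def)
    then have "A \<inter> {\<omega>\<in>space M. C k \<omega> = 0} \<inter> cell T = A \<inter> cell T"
      by (auto simp: cell_def)
    then show "prob (A \<inter> {\<omega>\<in>space M. C k \<omega> = 0} \<inter> cell T) = prob (A \<inter> cell T)" by simp
  qed
  finally show ?thesis .
qed

section \<open>Symmetry under flipping all causes\<close>

definition flip_invariant :: "'a set \<Rightarrow> bool" where
  "flip_invariant A \<longleftrightarrow> A \<in> events \<and>
    (\<forall>T. T \<subseteq> {1..n} \<longrightarrow> prob (A \<inter> cell ({1..n} - T)) = prob (A \<inter> cell T))"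

text \<open>Complementation exchanges the supports that contain \<open>k\<close> with those that do
  not, so the two values of \<open>C k\<close> split the mass of \<open>A\<close> equally.\<close>

lemma flip_invariant_prob_cause:
  assumes A: "flip_invariant A" and k: "k \<in> {1..n}" and b: "b \<in> {0, 1}"
  shows "prob (A \<inter> {\<omega>\<in>space M. C k \<omega> = b}) = prob A / 2"
proof -
  have ev: "A \<in> events" using A by (simp add: flip_invariant_def)
  have "(\<Sum>T\<in>{T\<in>Pow {1..n}. k \<notin> T}. prob (A \<inter> cell T))
      = (\<Sum>T\<in>{T\<in>Pow {1..n}. k \<in> T}. prob (A \<inter> cell T))"
    \<comment> \<open>Complementation is its own inverse, hence the same witness in both
      directions.\<close>
    by (rule sum.reindex_bij_witness[of _ "\<lambda>T. {1..n} - T" "\<lambda>T. {1..n} - T"])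
      (use A k in \<open>auto simp: flip_invariant_def double_diff\<close>)
  then have eq: "prob (A \<inter> {\<omega>\<in>space M. C k \<omega> = 0}) = prob (A \<inter> {\<omega>\<in>space M. C k \<omega> = 1})"
    by (simp only: prob_cause_0[OF ev k] prob_cause_1[OF ev k])
  have "A = (A \<inter> {\<omega>\<in>space M. C k \<omega> = 0}) \<union> (A \<inter> {\<omega>\<in>space M. C k \<omega> = 1})"
    using cause_bit[OF k] sets.sets_into_space[OF ev] by auto
  then have "prob A = prob ((A \<inter> {\<omega>\<in>space M. C k \<omega> = 0}) \<union> (A \<inter> {\<omega>\<in>space M. C k \<omega> = 1}))"
    by (rule arg_cong)
  also have "\<dots> = prob (A \<inter> {\<omega>\<in>space M. C k \<omega> = 0}) + prob (A \<inter> {\<omega>\<in>space M. C k \<omega> = 1})"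
    by (rule finite_measure_Union) (use ev cause_event[OF k] in auto)
  finally show ?thesis unfolding eq using eq b by (elim insertE emptyE) simp_all
qed

text \<open>Half of the mass is divided by the probability 1/2 of the conditioning event.\<close>

lemma flip_invariant_cond_prob:
  assumes A: "flip_invariant {\<omega>\<in>space M. P \<omega>}" and k: "k \<in> {1..n}" and b: "b \<in> {0, 1}"
  shows "\<P>(\<omega> in M. P \<omega> \<bar> C k \<omega> = b) = \<P>(\<omega> in M. P \<omega>)"
proof -
  have eq: "{\<omega>\<in>space M. P \<omega> \<and> C k \<omega> = b} = {\<omega>\<in>space M. P \<omega>} \<inter> {\<omega>\<in>space M. C k \<omega> = b}" by auto
  show ?thesis
    unfolding cond_prob_def eq flip_invariant_prob_cause[OF A k b] cause_prob[OF k b] by simp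
qed

text \<open>The origin of the symmetry: agreement with cause \<open>i\<close> does not depend on
  which value is called 1. Membership of \<open>i\<close> and the cardinality are complemented
  together.\<close>

lemma same_flip:
  assumes T: "T \<subseteq> {1..n}" and i: "i \<in> {1..n}"
  shows "same ({1..n} - T) i = same T i"
proof -
  have "card ({1..n} - T) = n - card T"
    using T by (subst card_Diff_subset) (auto intro: finite_subset)
  moreover have "card T \<le> n" using card_mono[OF _ T] by simp
  ultimately show ?thesis using i by (simp add: same_def)
qed

lemma flip_invariant_effect:
  assumes "n \<ge> 1" "i \<in> {1..n}"
  shows "flip_invariant {\<omega>\<in>space M. E i \<omega> = 1}"
  unfolding flip_invariant_def
  using assms by (auto intro: effect_event simp: effect_cell_prob same_flip)

lemma flip_invariant_effects:
  assumes "n \<ge> 1" "i \<in> {1..n}" "j \<in> {1..n}" "i \<noteq> j"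
  shows "flip_invariant {\<omega>\<in>space M. E i \<omega> = 1 \<and> E j \<omega> = 1}"
proof -
  have "{\<omega>\<in>space M. E i \<omega> = 1 \<and> E j \<omega> = 1}
      = {\<omega>\<in>space M. E i \<omega> = 1} \<inter> {\<omega>\<in>space M. E j \<omega> = 1}" by auto
  also have "\<dots> \<in> events"
    by (intro sets.Int effect_event assms)
  finally show ?thesis
    unfolding flip_invariant_def using assms by (simp add: effects_cell_prob same_flip)
qed

section \<open>Probabilities of one effect and of a pair\<close>

text \<open>Flip symmetry reduces to twice the sum over supports containing \<open>i\<close>, where
  \<open>same T i\<close> is just \<open>card T\<close>. The doubling turns \<open>2 ^ n\<close>
  into \<open>2 ^ (n - 1)\<close>.\<close>

lemma prob_effect:
  assumes n: "n \<ge> 1" and i: "i \<in> {1..n}"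
  shows "\<P>(\<omega> in M. E i \<omega> = 1) = 1 / 2 ^ (n - 1) * (\<Sum>k=0..n-1. real ((n - 1) choose k) * p (k + 1))"
proof -
  let ?A = "{\<omega>\<in>space M. E i \<omega> = 1}"
  let ?S = "{T\<in>Pow {1..n}. i \<in> T}"
  have S: "?S = insert i ` Pow ({1..n} - {i})"
  proof (intro equalityI subsetI)
    fix T assume "T \<in> ?S"
    then have "T = insert i (T - {i})" "T - {i} \<in> Pow ({1..n} - {i})" by auto
    then show "T \<in> insert i ` Pow ({1..n} - {i})" by blast
  qed (use i in auto)
  have "prob ?A = 2 * prob (?A \<inter> {\<omega>\<in>space M. C i \<omega> = 1})"
    using flip_invariant_prob_cause[OF flip_invariant_effect[OF n i] i, of 1] by simp
  also have "\<dots> = 2 * (\<Sum>T\<in>?S. p (card T) / 2 ^ n)"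
    unfolding prob_cause_1[OF effect_event[OF i] i]
    using n i by (auto simp: effect_cell_prob same_def)
  also have "\<dots> = 2 * (\<Sum>T\<in>?S. p (card T)) / 2 ^ n"
    unfolding sum_divide_distrib[symmetric] by simp
  also have "\<dots> = (\<Sum>T\<in>?S. p (card T)) / 2 ^ (n - 1)"
    using n by (cases n) auto
  also have "(\<Sum>T\<in>?S. p (card T)) = (\<Sum>k=0..n-1. real ((n - 1) choose k) * p (k + 1))"
    unfolding S using sum_Pow_insert_card[of "{1..n} - {i}" i p] i by simp
  finally show ?thesis by simp
qed

text \<open>Among the supports \<open>T\<close> containing \<open>i\<close>, those without
  \<open>j\<close> place the two effects in opposite groups and give
  \<open>p (card T) * p (n - card T)\<close>; those with \<open>j\<close> place them in the same
  group and give a square. These are the two terms of the second sum in \<open>psi\<close>.\<close>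

lemma prob_effects:
  assumes n: "n \<ge> 2" and i: "i \<in> {1..n}" and j: "j \<in> {1..n}" and ij: "i \<noteq> j"
  shows "\<P>(\<omega> in M. E i \<omega> = 1 \<and> E j \<omega> = 1) = 1 / 2 ^ (n - 1) *
    (\<Sum>k=0..n-2. real ((n - 2) choose k) * ((p (k + 2))\<^sup>2 + p (k + 1) * p (n - (k + 1))))"
proof -
  let ?A = "{\<omega>\<in>space M. E i \<omega> = 1 \<and> E j \<omega> = 1}"
  let ?S = "{T\<in>Pow {1..n}. i \<in> T}"
  let ?B = "{1..n} - {i, j}"
  let ?S1 = "insert i ` Pow ?B" and ?S2 = "insert i ` insert j ` Pow ?B"
  let ?f = "\<lambda>T. p (same T i) * p (same T j)"
  have n1: "n \<ge> 1" using n by simp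
  have inv: "flip_invariant ?A" by (rule flip_invariant_effects[OF n1 i j ij])
  have cB: "card ?B = n - 2" using i j ij by (subst card_Diff_subset) auto
  have S: "?S = ?S1 \<union> ?S2"
  proof (intro equalityI subsetI)
    fix T assume T: "T \<in> ?S"
    let ?T = "T - {i, j}"
    have P: "?T \<in> Pow ?B" using T by auto
    show "T \<in> ?S1 \<union> ?S2"
    proof (cases "j \<in> T")
      case True
      then have "T = insert i (insert j ?T)" using T by auto
      then show ?thesis using P by blast
    next
      case False
      then have "T = insert i ?T" using T by auto
      then show ?thesis using P by blast
    qed
  qed (use i j in auto)
  have disj: "?S1 \<inter> ?S2 = {}"
  proof -
    have "j \<notin> T" if "T \<in> ?S1" for T using that ij by auto
    moreover have "j \<in> T" if "T \<in> ?S2" for T using that by auto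
    ultimately show ?thesis by blast
  qed
  have "(\<Sum>T\<in>?S1. ?f T) = (\<Sum>T\<in>?S1. p (card T) * p (n - card T))"
  proof (rule sum.cong[OF refl])
    fix T assume "T \<in> ?S1"
    then have "i \<in> T" "j \<notin> T" using ij by auto
    then show "?f T = p (card T) * p (n - card T)" by (simp only: same_def if_True if_False)
  qed
  also have "\<dots> = (\<Sum>k=0..n-2. real ((n - 2) choose k) * (p (k + 1) * p (n - (k + 1))))"
    using sum_Pow_insert_card[of ?B i "\<lambda>c. p c * p (n - c)"] cB by simp
  finally have s1: "(\<Sum>T\<in>?S1. ?f T)
    = (\<Sum>k=0..n-2. real ((n - 2) choose k) * (p (k + 1) * p (n - (k + 1))))" .
  have inj: "inj_on (insert i) (insert j ` Pow ?B)"
  proof (rule inj_onI)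
    fix T U assume *: "T \<in> insert j ` Pow ?B" "U \<in> insert j ` Pow ?B" "insert i T = insert i U"
    then have "i \<notin> T" "i \<notin> U" using ij by auto
    then show "T = U" using *(3) by (simp add: insert_ident)
  qed
  \<comment> \<open>The two insertions are peeled off in turn: removing \<open>i\<close> leaves
    \<open>card T + 1\<close> inside the square, and removing \<open>j\<close> adds the second
    shift, for a total of \<open>k + 2\<close>.\<close>
  have "(\<Sum>T\<in>?S2. ?f T) = (\<Sum>T\<in>insert j ` Pow ?B. ?f (insert i T))"
    by (subst sum.reindex[OF inj]) simp
  also have "\<dots> = (\<Sum>T\<in>insert j ` Pow ?B. (p (card T + 1))\<^sup>2)"
  proof (rule sum.cong[OF refl])
    fix T assume "T \<in> insert j ` Pow ?B"
    then obtain U where U: "U \<subseteq> ?B" "T = insert j U" by auto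
    then have "finite U" by (auto intro: finite_subset)
    moreover have "i \<notin> T" "j \<in> T" using U ij by auto
    ultimately show "?f (insert i T) = (p (card T + 1))\<^sup>2"
      using U(2) by (simp add: same_def power2_eq_square Suc_eq_plus1)
  qed
  also have "\<dots> = (\<Sum>k=0..n-2. real ((n - 2) choose k) * (p (k + 2))\<^sup>2)"
    using sum_Pow_insert_card[of ?B j "\<lambda>c. (p (c + 1))\<^sup>2"] cB by (simp add: add.assoc one_add_one del: add_2_eq_Suc')
  finally have s2: "(\<Sum>T\<in>?S2. ?f T) = (\<Sum>k=0..n-2. real ((n - 2) choose k) * (p (k + 2))\<^sup>2)" .
  have "prob ?A = 2 * prob (?A \<inter> {\<omega>\<in>space M. C i \<omega> = 1})"
    using flip_invariant_prob_cause[OF inv i, of 1] by simp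
  also have "prob (?A \<inter> {\<omega>\<in>space M. C i \<omega> = 1}) = (\<Sum>T\<in>?S. prob (?A \<inter> cell T))"
    by (rule prob_cause_1[OF _ i]) (use inv in \<open>simp add: flip_invariant_def\<close>)
  also have "\<dots> = (\<Sum>T\<in>?S. ?f T / 2 ^ n)"
    by (rule sum.cong) (use n1 i j ij in \<open>auto simp: effects_cell_prob\<close>)
  also have "2 * \<dots> = 2 * (\<Sum>T\<in>?S. ?f T) / 2 ^ n"
    unfolding sum_divide_distrib[symmetric] by simp
  also have "\<dots> = (\<Sum>T\<in>?S. ?f T) / 2 ^ (n - 1)"
    using n by (cases n) auto
  also have "(\<Sum>T\<in>?S. ?f T) = (\<Sum>T\<in>?S1. ?f T) + (\<Sum>T\<in>?S2. ?f T)"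
    unfolding S by (rule sum.union_disjoint) (use disj in auto)
  also have "\<dots> = (\<Sum>k=0..n-2. real ((n - 2) choose k) *
      ((p (k + 2))\<^sup>2 + p (k + 1) * p (n - (k + 1))))"
    unfolding s1 s2 sum.distrib[symmetric] by (rule sum.cong) (simp_all only: distrib_left add.commute)
  finally show ?thesis by simp
qed

section \<open>The two equivalences\<close>

text \<open>The marginals do not depend on the index, so their product is the square in
  \<open>psi\<close>, and the subtracted term is the joint probability. The criterion is therefore
  the same for every pair.\<close>

lemma indep_effects_iff:
  assumes "n \<ge> 2" "i \<in> {1..n}" "j \<in> {1..n}" "i \<noteq> j"
  shows "indep_var bit_space (E i) bit_space (E j) \<longleftrightarrow> psi n p = 0"
proof -
  have n: "n \<ge> 1" using assms(1) by simp
  show ?thesis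
    unfolding indep_var_bits_iff[OF effects_rv[OF assms(2)] effects_rv[OF assms(3)]]
      prob_effect[OF n assms(2)] prob_effect[OF n assms(3)] prob_effects[OF assms] psi_def
      power2_eq_square right_minus_eq
    by (rule eq_commute)
qed

text \<open>All three events involved are flip-invariant, so for either value of \<open>C k\<close>
  the screening equation is the unconditional product rule.\<close>

lemma screens_off_iff:
  assumes "n \<ge> 1" "i \<in> {1..n}" "j \<in> {1..n}" "i \<noteq> j" "k \<in> {1..n}"
  shows "screens_off M (C k) (E i) (E j) \<longleftrightarrow> indep_var bit_space (E i) bit_space (E j)"
  unfolding indep_var_bits_iff[OF effects_rv[OF assms(2)] effects_rv[OF assms(3)]] screens_off_def
  using flip_invariant_cond_prob[OF flip_invariant_effect[OF assms(1,2)] assms(5)]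
    flip_invariant_cond_prob[OF flip_invariant_effect[OF assms(1,3)] assms(5)]
    flip_invariant_cond_prob[OF flip_invariant_effects[OF assms(1-4)] assms(5)]
  by auto

end

theorem proposition3p2:
  fixes M :: "'a measure" and n :: nat and p :: "nat \<Rightarrow> real"
    and C E :: "nat \<Rightarrow> 'a \<Rightarrow> nat"
  assumes "n \<ge> 2"
    and "\<And>k. k \<in> {1..n} \<Longrightarrow> p k \<in> {0..1}"
    and "symmetric_model M n p C E"
  shows "(pairwise_indep_effects M n E \<longleftrightarrow> psi n p = 0) \<and>
    (pairwise_indep_effects M n E \<longleftrightarrow>
      (\<forall>i\<in>{1..n}. \<forall>j\<in>{1..n}. i \<noteq> j \<longrightarrow> (\<forall>k\<in>{1..n}. screens_off M (C k) (E i) (E j))))"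
proof -
  interpret symmetric_model M n p C E by (rule assms(3))
  \<comment> \<open>A concrete pair of distinct effects: without one, pairwise independence would
    hold vacuously and give no information on \<open>psi\<close>.\<close>
  have mem: "1 \<in> {1..n}" "2 \<in> {1..n}" "(1::nat) \<noteq> 2" using assms(1) by auto
  have "pairwise_indep_effects M n E \<longleftrightarrow> psi n p = 0"
    unfolding pairwise_indep_effects_def using indep_effects_iff[OF assms(1)] mem by blast
  \<comment> \<open>From right to left, one cause \<open>k\<close> is enough for each pair, and
    \<open>1\<close> is available.\<close>
  moreover have "pairwise_indep_effects M n E \<longleftrightarrow>
      (\<forall>i\<in>{1..n}. \<forall>j\<in>{1..n}. i \<noteq> j \<longrightarrow> (\<forall>k\<in>{1..n}. screens_off M (C k) (E i) (E j)))"
    unfolding pairwise_indep_effects_def using screens_off_iff mem assms(1)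
    by (metis One_nat_def atLeastAtMost_iff)
  ultimately show ?thesis by blast
qed

end
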